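(* For every integer $n\ge 2$, \[p_b(P_n)=\begin{cases} \frac{n}{4} & \text{if } n\equiv 0\pmod 8,\\ 2\left\lfloor\frac{n}{8}\right\rfloor+1 & \text{if } n\equiv 1,2,3\pmod 8,\\ 2\left\lfloor\frac{n}{8}\right\rfloor+2 & \text{if } n\equiv 4,5,6,7\pmod 8,\end{cases}\] where $P_n$ is the path of order $n$.
   Context: For a graph $G=(V,E)$, a broadcast is a function $f:V\to\{0,\dots,\operatorname{diam}(G)\}$ with $f(v)\le e_G(v)$ (eccentricity) for all $v$. Let $V^+_f=\{v: f(v)>0\}$ and $H_f(u)=\{v\in V^+_f: d_G(u,v)\le f(v)\}$. The cost is $\sigma(f)=\sum_v f(v)$. $f$ is a packing broadcast if $|H_f(u)|\le1$ for every $u\in V$; it is maximal if no packing broadcast $g\ne f$ satisfies $g\ge f$ pointwise. $p_b(G)$ is the minimum cost of a maximal packing broadcast on $G$. *)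

theory Defs
  imports "Graph_Theory.Pair_Digraph" "HOL-Library.FuncSet"
begin

text \<open>
  Finite simple graphs are represented, as in the \<^locale>\<open>pair_graph\<close> locale, by finite, symmetric,
  loop-free pair digraphs: each edge \<open>uv\<close> appears as the two arcs \<open>(u, v)\<close> and \<open>(v, u)\<close>.

  The distance is a natural number, so it is meaningful only for vertices joined by a walk; it is
  intended for connected graphs, where the eccentricity and the diameter are finite.
\<close>

definition gdist :: "'a pair_pre_digraph \<Rightarrow> 'a \<Rightarrow> 'a \<Rightarrow> nat" where
  "gdist G u v = (LEAST k. \<exists>p. pre_digraph.awalk (with_proj G) u p v \<and> length p = k)"

definition eccentricity :: "'a pair_pre_digraph \<Rightarrow> 'a \<Rightarrow> nat" where
  "eccentricity G v = Max (gdist G v ` pverts G)"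

definition diam :: "'a pair_pre_digraph \<Rightarrow> nat" where
  "diam G = Max {gdist G u v | u v. u \<in> pverts G \<and> v \<in> pverts G}"

text \<open>
  Functions on the vertex set are extensional, so that two broadcasts are equal iff they agree on
  every vertex.
\<close>

definition broadcast :: "'a pair_pre_digraph \<Rightarrow> ('a \<Rightarrow> nat) \<Rightarrow> bool" where
  "broadcast G f \<longleftrightarrow>
     f \<in> pverts G \<rightarrow>\<^sub>E {0..diam G} \<and> (\<forall>v\<in>pverts G. f v \<le> eccentricity G v)"

definition broadcast_support :: "'a pair_pre_digraph \<Rightarrow> ('a \<Rightarrow> nat) \<Rightarrow> 'a set" where
  "broadcast_support G f = {v \<in> pverts G. f v > 0}"

definition hearing_set :: "'a pair_pre_digraph \<Rightarrow> ('a \<Rightarrow> nat) \<Rightarrow> 'a \<Rightarrow> 'a set" where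
  "hearing_set G f u = {v \<in> broadcast_support G f. gdist G u v \<le> f v}"

definition broadcast_cost :: "'a pair_pre_digraph \<Rightarrow> ('a \<Rightarrow> nat) \<Rightarrow> nat" where
  "broadcast_cost G f = (\<Sum>v\<in>pverts G. f v)"

definition packing_broadcast :: "'a pair_pre_digraph \<Rightarrow> ('a \<Rightarrow> nat) \<Rightarrow> bool" where
  "packing_broadcast G f \<longleftrightarrow>
     broadcast G f \<and> (\<forall>u\<in>pverts G. card (hearing_set G f u) \<le> 1)"

definition maximal_packing_broadcast :: "'a pair_pre_digraph \<Rightarrow> ('a \<Rightarrow> nat) \<Rightarrow> bool" where
  "maximal_packing_broadcast G f \<longleftrightarrow>
     packing_broadcast G f \<and>
     \<not> (\<exists>g. packing_broadcast G g \<and> g \<noteq> f \<and> (\<forall>v\<in>pverts G. f v \<le> g v))"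

definition lower_broadcast_packing_number :: "'a pair_pre_digraph \<Rightarrow> nat" ("p\<^sub>b") where
  "p\<^sub>b G = Min (broadcast_cost G ` {f. maximal_packing_broadcast G f})"

definition path_graph :: "nat \<Rightarrow> nat pair_pre_digraph" where
  "path_graph n =
     \<lparr> pverts = {1..n},
       parcs = {(i, j). i \<in> {1..n} \<and> j \<in> {1..n} \<and> (j = i + 1 \<or> i = j + 1)} \<rparr>"

lemma pair_graph_path_graph: "pair_graph (path_graph n)"
proof -
  have "finite (parcs (path_graph n))"
    by (rule finite_subset[of _ "{1..n} \<times> {1..n}"]) (auto simp: path_graph_def)
  moreover have "symmetric (path_graph n)"
    by (auto simp: symmetric_def sym_def path_graph_def)
  ultimately show ?thesis
    by unfold_locales (auto simp: path_graph_def)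
qed

text \<open>The minimum defining \<open>p\<^sub>b\<close> is attained on every finite graph.\<close>

lemma finite_maximal_packing_broadcasts:
  assumes "finite (pverts G)"
  shows "finite {f. maximal_packing_broadcast G f}"
proof (rule finite_subset)
  show "{f. maximal_packing_broadcast G f} \<subseteq> pverts G \<rightarrow>\<^sub>E {0..diam G}"
    by (auto simp: maximal_packing_broadcast_def packing_broadcast_def broadcast_def)
  show "finite (pverts G \<rightarrow>\<^sub>E {0..diam G})"
    using assms by (intro finite_PiE) auto
qed

lemma maximal_packing_broadcast_exists:
  assumes fin: "finite (pverts G)"
  shows "\<exists>f. maximal_packing_broadcast G f"
proof -
  let ?P = "{f. packing_broadcast G f}"
  have "?P \<subseteq> pverts G \<rightarrow>\<^sub>E {0..diam G}"
    by (auto simp: packing_broadcast_def broadcast_def)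
  moreover have "finite (pverts G \<rightarrow>\<^sub>E {0..diam G})"
    using fin by (intro finite_PiE) auto
  ultimately have finP: "finite ?P" by (rule finite_subset)
  have "packing_broadcast G (\<lambda>v\<in>pverts G. 0)"
    by (auto simp: packing_broadcast_def broadcast_def hearing_set_def broadcast_support_def
        cong: conj_cong)
  then have neP: "?P \<noteq> {}" by blast
  have "Max (broadcast_cost G ` ?P) \<in> broadcast_cost G ` ?P"
    using finP neP by (intro Max_in) auto
  then obtain f where f: "packing_broadcast G f"
    and f_Max: "broadcast_cost G f = Max (broadcast_cost G ` ?P)" by auto
  have mx: "broadcast_cost G g \<le> broadcast_cost G f" if "packing_broadcast G g" for g
    unfolding f_Max using finP that by (intro Max_ge) auto
  have "g = f" if g: "packing_broadcast G g" and le: "\<forall>v\<in>pverts G. f v \<le> g v" for g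
  proof (rule ccontr)
    assume "g \<noteq> f"
    moreover have "g \<in> extensional (pverts G)" "f \<in> extensional (pverts G)"
      using f g by (auto simp: packing_broadcast_def broadcast_def PiE_def)
    ultimately obtain v where "v \<in> pverts G" "f v \<noteq> g v"
      by (metis extensionalityI)
    with le have "\<exists>v\<in>pverts G. f v < g v"
      by (metis le_neq_implies_less)
    with le fin have "broadcast_cost G f < broadcast_cost G g"
      unfolding broadcast_cost_def by (intro sum_strict_mono_ex1) auto
    with mx[OF g] show False by simp
  qed
  with f show ?thesis
    unfolding maximal_packing_broadcast_def by blast
qed

end

theory Submission
  imports Defs
begin

text \<open>
  A maximal packing broadcast on a path is a family of pairwise disjoint balls such that at most two
  vertices are uncovered between consecutive balls, at most one at each end, and, unless a single
  ball covers the whole path, every ball is adjacent to another one. Balls of radius one have the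
  best ratio of length to cost, and they cover most when adjacent pairs alternate with gaps of two
  vertices: each such pair costs 2 and accounts for 8 vertices. When the cost is odd, three
  adjacent balls of radius one replace one of the pairs.
\<close>

section \<open>Distances and eccentricities on paths\<close>

lemma pverts_path_graph [simp]: "pverts (path_graph n) = {1..n}"
  by (simp add: path_graph_def)

lemma arc_path_graph:
  "e \<in> parcs (path_graph n) \<longleftrightarrow>
     fst e \<in> {1..n} \<and> snd e \<in> {1..n} \<and> (snd e = fst e + 1 \<or> fst e = snd e + 1)"
  by (cases e) (simp add: path_graph_def)

lemma path_graph_awalk_Cons_iff:
  "pre_digraph.awalk (with_proj (path_graph n)) u (e # p) v \<longleftrightarrow>
     e \<in> parcs (path_graph n) \<and> fst e = u \<and>
     pre_digraph.awalk (with_proj (path_graph n)) (snd e) p v"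
proof -
  interpret pair_graph "path_graph n" by (rule pair_graph_path_graph)
  show ?thesis by (auto simp: awalk_Cons_iff)
qed

lemma path_graph_awalk_Nil_iff:
  "pre_digraph.awalk (with_proj (path_graph n)) u [] v \<longleftrightarrow> u = v \<and> u \<in> {1..n}"
proof -
  interpret pair_graph "path_graph n" by (rule pair_graph_path_graph)
  show ?thesis by (auto simp: awalk_Nil_iff)
qed

text \<open>Each arc changes the vertex number by exactly one; this gives the lower bound on
  distances, and the monotone walks built below attain it.\<close>

lemma path_graph_awalk_length:
  assumes "pre_digraph.awalk (with_proj (path_graph n)) u p v"
  shows "u \<le> v + length p \<and> v \<le> u + length p"
  using assms
  by (induction p arbitrary: u)
     (force simp: path_graph_awalk_Cons_iff path_graph_awalk_Nil_iff arc_path_graph)+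

lemma path_graph_awalk_exists:
  assumes "1 \<le> u" "u + k \<le> n"
  shows "\<exists>p. pre_digraph.awalk (with_proj (path_graph n)) u p (u + k) \<and> length p = k"
  using assms
proof (induction k arbitrary: u)
  case 0
  then show ?case by (auto simp: path_graph_awalk_Nil_iff)
next
  case (Suc k)
  from Suc.IH[of "u + 1"] Suc.prems obtain p where
    "pre_digraph.awalk (with_proj (path_graph n)) (u + 1) p (u + 1 + k)" "length p = k"
    by auto
  then show ?case using Suc.prems
    by (intro exI[of _ "(u, u + 1) # p"]) (auto simp: path_graph_awalk_Cons_iff arc_path_graph)
qed

lemma path_graph_awalk_exists_rev:
  assumes "1 \<le> u" "u + k \<le> n"
  shows "\<exists>p. pre_digraph.awalk (with_proj (path_graph n)) (u + k) p u \<and> length p = k"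
  using assms
proof (induction k)
  case 0
  then show ?case by (auto simp: path_graph_awalk_Nil_iff)
next
  case (Suc k)
  from Suc.IH Suc.prems obtain p where
    "pre_digraph.awalk (with_proj (path_graph n)) (u + k) p u" "length p = k"
    by auto
  then show ?case using Suc.prems
    by (intro exI[of _ "(u + Suc k, u + k) # p"])
       (auto simp: path_graph_awalk_Cons_iff arc_path_graph)
qed

lemma gdist_path_graph:
  assumes "u \<in> {1..n}" "v \<in> {1..n}"
  shows "gdist (path_graph n) u v = (u - v) + (v - u)"
  unfolding gdist_def
proof (rule Least_equality)
  show "\<exists>p. pre_digraph.awalk (with_proj (path_graph n)) u p v \<and> length p = (u - v) + (v - u)"
    using path_graph_awalk_exists[of u "v - u" n] path_graph_awalk_exists_rev[of v "u - v" n] assms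
    by (cases "u \<le> v") auto
  show "(u - v) + (v - u) \<le> k"
    if "\<exists>p. pre_digraph.awalk (with_proj (path_graph n)) u p v \<and> length p = k" for k
    using that path_graph_awalk_length[of n u _ v] by fastforce
qed

lemma eccentricity_path_graph:
  assumes "v \<in> {1..n}"
  shows "eccentricity (path_graph n) v = max (v - 1) (n - v)"
  unfolding eccentricity_def
proof (rule Max_eqI)
  show "finite (gdist (path_graph n) v ` pverts (path_graph n))" by simp
  show "y \<le> max (v - 1) (n - v)" if "y \<in> gdist (path_graph n) v ` pverts (path_graph n)" for y
    using that assms by (auto simp: gdist_path_graph)
  have "v - 1 = gdist (path_graph n) v 1" "n - v = gdist (path_graph n) v n"
    using assms by (simp_all add: gdist_path_graph)
  moreover have "1 \<in> pverts (path_graph n)" "n \<in> pverts (path_graph n)"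
    using assms by auto
  ultimately show "max (v - 1) (n - v) \<in> gdist (path_graph n) v ` pverts (path_graph n)"
    by (metis imageI max_def)
qed

lemma eccentricity_le_diam:
  assumes "finite (pverts G)" "v \<in> pverts G"
  shows "eccentricity G v \<le> diam G"
  unfolding eccentricity_def diam_def
proof (rule Max_mono)
  show "gdist G v ` pverts G \<subseteq> {gdist G u w |u w. u \<in> pverts G \<and> w \<in> pverts G}"
    using assms by auto
  show "gdist G v ` pverts G \<noteq> {}" using assms by auto
  have "{gdist G u w |u w. u \<in> pverts G \<and> w \<in> pverts G} =
      (\<lambda>(u, w). gdist G u w) ` (pverts G \<times> pverts G)" by auto
  then show "finite {gdist G u w |u w. u \<in> pverts G \<and> w \<in> pverts G}"
    using assms by simp
qed

section \<open>Packing and maximality on paths as arithmetic conditions\<close>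

lemma broadcast_iff:
  assumes "finite (pverts G)"
  shows "broadcast G f \<longleftrightarrow>
    f \<in> extensional (pverts G) \<and> (\<forall>v\<in>pverts G. f v \<le> eccentricity G v)"
  using eccentricity_le_diam[OF assms]
  by (fastforce simp: broadcast_def PiE_def Pi_def)

text \<open>Two balls on a path share a vertex exactly when the distance of their centres is at most
  the sum of their radii, so bounding the hearing sets amounts to strict separation of all ordered
  pairs of broadcasting vertices.\<close>

lemma packing_broadcast_path_graph_iff:
  "packing_broadcast (path_graph n) f \<longleftrightarrow>
     f \<in> extensional {1..n} \<and> (\<forall>v\<in>{1..n}. f v \<le> max (v - 1) (n - v)) \<and>
     (\<forall>u\<in>{1..n}. \<forall>w\<in>{1..n}. 0 < f u \<longrightarrow> 0 < f w \<longrightarrow> u < w \<longrightarrow> u + f u + f w < w)"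
    (is "_ \<longleftrightarrow> ?ext \<and> ?ecc \<and> ?sep")
proof -
  let ?H = "hearing_set (path_graph n) f"
  have fin: "finite (?H x)" for x
    by (simp add: hearing_set_def broadcast_support_def)
  have mem: "v \<in> ?H x \<longleftrightarrow> v \<in> {1..n} \<and> 0 < f v \<and> x \<le> v + f v \<and> v \<le> x + f v"
    if "x \<in> {1..n}" for x v
    using that by (auto simp: hearing_set_def broadcast_support_def gdist_path_graph)
  have "(\<forall>x\<in>{1..n}. card (?H x) \<le> 1) \<longleftrightarrow> ?sep"
  proof (intro iffI ballI impI)
    fix u w
    assume card: "\<forall>x\<in>{1..n}. card (?H x) \<le> 1"
      and u: "u \<in> {1..n}" "0 < f u" and w: "w \<in> {1..n}" "0 < f w" and "u < w"
    show "u + f u + f w < w"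
    proof (rule ccontr)
      assume *: "\<not> u + f u + f w < w"
      \<comment> \<open>A vertex between \<open>u\<close> and \<open>w\<close> in both balls; the ends of the path do not interfere.\<close>
      define x where "x = max u (w - f w)"
      have x: "x \<in> {1..n}" using u w \<open>u < w\<close> by (auto simp: x_def)
      have "u \<in> ?H x" "w \<in> ?H x"
        using u w \<open>u < w\<close> * unfolding mem[OF x] by (auto simp: x_def)
      then have "u = w"
        using card x fin[of x] by (metis One_nat_def card_le_Suc0_iff_eq)
      with \<open>u < w\<close> show False by simp
    qed
  next
    fix x
    assume sep: ?sep and x: "x \<in> {1..n}"
    have "u = w" if "u \<in> ?H x" "w \<in> ?H x" for u w
    proof (rule ccontr)
      assume "u \<noteq> w"
      then consider "u < w" | "w < u" by linarith
      then show False
      proof cases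
        case 1
        with sep that mem[OF x] have "u + f u + f w < w" by blast
        with that mem[OF x] show False by fastforce
      next
        case 2
        with sep that mem[OF x] have "w + f w + f u < u" by blast
        with that mem[OF x] show False by fastforce
      qed
    qed
    then show "card (?H x) \<le> 1"
      using fin[of x] by (metis One_nat_def card_le_Suc0_iff_eq)
  qed
  moreover have "broadcast (path_graph n) f \<longleftrightarrow> ?ext \<and> ?ecc"
    by (simp add: broadcast_iff eccentricity_path_graph)
  ultimately show ?thesis
    by (simp add: packing_broadcast_def)
qed

text \<open>
  Since lowering values preserves the packing property, it suffices to consider raising a single
  value by one.
\<close>

lemma maximal_packing_broadcast_path_graph_iff:
  "maximal_packing_broadcast (path_graph n) f \<longleftrightarrow>
     packing_broadcast (path_graph n) f \<and>
     (\<forall>v\<in>{1..n}. f v = max (v - 1) (n - v) \<or>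
        (\<exists>w\<in>{1..n}. w \<noteq> v \<and> 0 < f w \<and> v \<le> w + f v + f w + 1 \<and> w \<le> v + f v + f w + 1))"
    (is "_ \<longleftrightarrow> _ \<and> (\<forall>v\<in>_. ?full v \<or> ?blocked v)")
proof (intro iffI conjI ballI)
  assume "maximal_packing_broadcast (path_graph n) f"
  then have f: "packing_broadcast (path_graph n) f"
    and max: "\<And>g. packing_broadcast (path_graph n) g \<Longrightarrow> \<forall>v\<in>{1..n}. f v \<le> g v \<Longrightarrow> g = f"
    by (auto simp: maximal_packing_broadcast_def)
  show "packing_broadcast (path_graph n) f" by (rule f)
  fix v
  assume v: "v \<in> {1..n}"
  show "?full v \<or> ?blocked v"
  proof (rule ccontr)
    assume not: "\<not> (?full v \<or> ?blocked v)"
    let ?g = "f(v := f v + 1)"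
    have ecc: "f u \<le> max (u - 1) (n - u)" if "u \<in> {1..n}" for u
      using f that unfolding packing_broadcast_path_graph_iff by blast
    have sep: "u + f u + f w < w"
      if "u \<in> {1..n}" "w \<in> {1..n}" "0 < f u" "0 < f w" "u < w" for u w
      using f that unfolding packing_broadcast_path_graph_iff by blast
    \<comment> \<open>This is the separation inequality for \<open>v\<close> with its radius already
      raised by one. It also covers the case \<open>f v = 0\<close>, where \<open>v\<close> only
      becomes a broadcasting vertex in \<open>?g\<close>.\<close>
    have free: "w + f v + f w + 1 < v \<or> v + f v + f w + 1 < w"
      if "w \<in> {1..n}" "w \<noteq> v" "0 < f w" for w
      using not that by (meson not_le)
    have "packing_broadcast (path_graph n) ?g"
      unfolding packing_broadcast_path_graph_iff
    proof (intro conjI ballI impI)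
      show "?g \<in> extensional {1..n}"
        using f v by (auto simp: packing_broadcast_path_graph_iff extensional_def)
      show "?g u \<le> max (u - 1) (n - u)" if "u \<in> {1..n}" for u
        using ecc[OF that] not by (cases "u = v") auto
      show "u + ?g u + ?g w < w"
        if "u \<in> {1..n}" "w \<in> {1..n}" "0 < ?g u" "0 < ?g w" "u < w" for u w
        using that sep[of u w] free[of u] free[of w] by (auto split: if_splits)
    qed
    then have "?g = f" by (rule max) simp
    then show False by (metis fun_upd_same n_not_Suc_n Suc_eq_plus1)
  qed
next
  assume "packing_broadcast (path_graph n) f \<and> (\<forall>v\<in>{1..n}. ?full v \<or> ?blocked v)"
  then have f: "packing_broadcast (path_graph n) f"
    and tight: "\<And>v. v \<in> {1..n} \<Longrightarrow> ?full v \<or> ?blocked v" by blast+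
  have "g = f" if g: "packing_broadcast (path_graph n) g" and le: "\<forall>v\<in>{1..n}. f v \<le> g v" for g
  proof (rule ccontr)
    assume "g \<noteq> f"
    moreover have "g \<in> extensional {1..n}" "f \<in> extensional {1..n}"
      using f g unfolding packing_broadcast_path_graph_iff by blast+
    ultimately obtain v where v: "v \<in> {1..n}" "f v \<noteq> g v"
      by (metis extensionalityI)
    with le have less: "f v < g v" by (simp add: le_neq_implies_less)
    have "g v \<le> max (v - 1) (n - v)"
      using g v unfolding packing_broadcast_path_graph_iff by blast
    \<comment> \<open>Since \<open>g v\<close> exceeds \<open>f v\<close> and respects the
      eccentricity, \<open>v\<close> is not full. Its blocker \<open>w\<close> is at distance at
      most \<open>f v + 1 + f w\<close>, hence at most \<open>g v + g w\<close>, against the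
      separation of \<open>g\<close>.\<close>
    with less tight[OF v(1)] obtain w where w: "w \<in> {1..n}" "w \<noteq> v" "0 < f w"
      "v \<le> w + f v + f w + 1" "w \<le> v + f v + f w + 1" by auto
    have "f w \<le> g w" using le w by blast
    have sep: "u + g u + g w < w"
      if "u \<in> {1..n}" "w \<in> {1..n}" "0 < g u" "0 < g w" "u < w" for u w
      using g that unfolding packing_broadcast_path_graph_iff by blast
    show False
      using sep[of v w] sep[of w v] v w less \<open>f w \<le> g w\<close> by linarith
  qed
  with f show "maximal_packing_broadcast (path_graph n) f"
    by (auto simp: maximal_packing_broadcast_def)
qed

section \<open>Lower bound on the cost\<close>

text \<open>
  Scan the broadcasting vertices from left to right, writing \<open>c\<close> for the cost accumulated up to and
  including \<open>v\<close>. The ball of \<open>v\<close> ends at \<open>v + f v\<close>. At most two vertices lie between consecutive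
  balls, and every ball touches one of its neighbours; whether it touches the left one is the state
  that the induction has to remember.
\<close>

lemma maximal_packing_broadcast_prefix_bound:
  assumes f: "maximal_packing_broadcast (path_graph n) f" and n: "2 \<le> n"
    and not_full: "\<And>v. v \<in> {1..n} \<Longrightarrow> 0 < f v \<Longrightarrow> f v \<noteq> max (v - 1) (n - v)"
    and v: "v \<in> {1..n}" "0 < f v" and c: "c = sum f {1..v}"
  shows "v + f v \<le> 4 * c \<and> (even c \<longrightarrow> v + f v + 1 \<le> 4 * c) \<and>
    ((\<exists>w\<in>{1..n}. 0 < f w \<and> v = w + f w + f v + 1) \<longrightarrow>
       v + f v + 1 \<le> 4 * c \<and> (odd c \<longrightarrow> v + f v + 2 \<le> 4 * c))"
  using v c
proof (induction v arbitrary: c rule: less_induct)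
  case (less v)
  define touches where
    "touches u \<longleftrightarrow> (\<exists>w\<in>{1..n}. 0 < f w \<and> u = w + f w + f u + 1)" for u
  have sep: "u + f u + f w < w"
    if "u \<in> {1..n}" "w \<in> {1..n}" "0 < f u" "0 < f w" "u < w" for u w
    using f that
    unfolding maximal_packing_broadcast_path_graph_iff packing_broadcast_path_graph_iff by blast
  have tight: "f u = max (u - 1) (n - u) \<or> (\<exists>w\<in>{1..n}. w \<noteq> u \<and> 0 < f w \<and>
      u \<le> w + f u + f w + 1 \<and> w \<le> u + f u + f w + 1)" if "u \<in> {1..n}" for u
    using f that unfolding maximal_packing_broadcast_path_graph_iff by blast
  show ?case
  proof (cases "\<exists>w\<in>{1..n}. w < v \<and> 0 < f w")
    case False
    \<comment> \<open>At most one vertex precedes the first ball; otherwise vertex 1 could be raised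
      from 0 to 1. Hence the ball ends by \<open>2 * f v + 2\<close>, which is \<open>4 * c\<close>
      for radius one and at most \<open>4 * c - 2\<close> for larger radii.\<close>
    have "v \<le> f v + 2"
    proof (rule ccontr)
      assume far: "\<not> v \<le> f v + 2"
      then have "f 1 = 0" using False less.prems by force
      moreover have "1 \<in> {1..n}" using n by simp
      ultimately obtain w where w: "w \<in> {1..n}" "0 < f w" "w \<le> f w + 2"
        using tight[of 1] n by force
      then show False
        using far False sep[of v w] less.prems by (cases "w = v") force+
    qed
    moreover have "c = f v"
    proof -
      have "sum f {1..v} = sum f {v}"
      proof (rule sum.mono_neutral_right)
        show "\<forall>i\<in>{1..v} - {v}. f i = 0"
        proof
          fix i
          assume "i \<in> {1..v} - {v}"
          then have "i \<in> {1..n}" "i < v" using less.prems by auto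
          with False show "f i = 0" by (meson gr0I)
        qed
      qed (use less.prems in auto)
      then show ?thesis using less.prems by simp
    qed
    moreover have "\<not> touches v" using False by (force simp: touches_def)
    ultimately show ?thesis
      unfolding touches_def[symmetric] using less.prems(2) by (cases "f v = 1") simp_all
  next
    case True
    define w where "w = Max {w \<in> {1..n}. w < v \<and> 0 < f w}"
    have "w \<in> {w \<in> {1..n}. w < v \<and> 0 < f w}"
      unfolding w_def using True by (intro Max_in) auto
    then have w: "w \<in> {1..n}" "w < v" "0 < f w" by auto
    have pred: "u \<le> w" if "u \<in> {1..n}" "u < v" "0 < f u" for u
      unfolding w_def using that by (intro Max_ge) auto
    have sep_wv: "w + f w + f v < v"
      using sep[of w v] w less.prems by simp
    have gap: "v \<le> w + f w + f v + 3"
    proof (rule ccontr)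
      assume far: "\<not> v \<le> w + f w + f v + 3"
      \<comment> \<open>With three or more uncovered vertices between the two balls, the second one
        after the ball of \<open>w\<close> has uncovered neighbours on both sides, so nothing blocks
        raising it to 1.\<close>
      define x where "x = w + f w + 2"
      have x: "x \<in> {1..n}" "w < x" "x < v" using far w less.prems by (auto simp: x_def)
      then have "f x = 0" using pred[of x] by force
      then obtain y where y: "y \<in> {1..n}" "0 < f y" "x \<le> y + f y + 1" "y \<le> x + f y + 1"
        using tight[OF x(1)] x n by force
      consider "y < w" | "y = w" | "y = v" | "v < y"
        using pred[of y] y by force
      then show False
        using sep[of y w] sep[of v y] w y less.prems far by cases (auto simp: x_def)
    qed
    define d where "d = sum f {1..w}"
    have c: "c = d + f v"
    proof -
      have "sum f {1..v} = sum f {1..<v} + f v"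
        using less.prems by (simp add: atLeastLessThanSuc_atLeastAtMost[symmetric])
      moreover have "sum f {1..<v} = sum f {1..w}"
      proof (rule sum.mono_neutral_right)
        show "\<forall>i\<in>{1..<v} - {1..w}. f i = 0"
        proof
          fix i
          assume "i \<in> {1..<v} - {1..w}"
          with pred[of i] less.prems show "f i = 0" by force
        qed
      qed (use w in auto)
      ultimately show ?thesis using less.prems by (simp add: d_def)
    qed
    have IH: "w + f w \<le> 4 * d \<and> (even d \<longrightarrow> w + f w + 1 \<le> 4 * d) \<and>
      (touches w \<longrightarrow> w + f w + 1 \<le> 4 * d \<and> (odd d \<longrightarrow> w + f w + 2 \<le> 4 * d))"
      unfolding touches_def using less.IH[OF w(2) w(1) w(3) d_def] .
    have touch_pred: "touches v \<longleftrightarrow> v = w + f w + f v + 1"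
    proof
      assume "touches v"
      then obtain y where y: "y \<in> {1..n}" "0 < f y" "v = y + f y + f v + 1"
        by (auto simp: touches_def)
      with pred[of y] sep[of y w] w sep_wv have "y = w" by force
      with y show "v = w + f w + f v + 1" by simp
    qed (use w in \<open>auto simp: touches_def\<close>)
    \<comment> \<open>As \<open>w\<close> is not full, some ball blocks it, and blocking together
      with separation means adjacency. Every ball to the right starts no earlier than that of
      \<open>v\<close>, which is not adjacent, so the adjacent ball lies to the left.\<close>
    have "touches w" if "\<not> touches v"
    proof -
      obtain y where y: "y \<in> {1..n}" "y \<noteq> w" "0 < f y"
        "w \<le> y + f w + f y + 1" "y \<le> w + f w + f y + 1"
        using tight[OF w(1)] not_full[OF w(1) w(3)] by blast
      have "y < w"
      proof (rule ccontr)
        assume "\<not> y < w"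
        then have "v \<le> y" using pred[of y] y by force
        then show False
          using that touch_pred sep_wv sep[of v y] y less.prems by (cases "y = v") auto
      qed
      then have "w = y + f y + f w + 1" using sep[of y w] y w by force
      then show ?thesis using y by (auto simp: touches_def)
    qed
    moreover have "v \<le> w + f w + f v + 1" if "touches v"
      using that touch_pred by simp
    \<comment> \<open>The right end may be at most \<open>4 * c\<close> (not touching, odd),
      \<open>4 * c - 1\<close> (even) or \<open>4 * c - 2\<close> (touching, odd). A ball of radius
      one flips the parity and moves the end by 3 if it touches, by at most 5 otherwise; in the
      latter case \<open>w\<close> touches, and all four combinations just fit. Larger radii leave
      slack because the end moves by at most \<open>2 * f v + 3\<close> while the allowance grows by
      \<open>4 * f v\<close>.\<close>
    ultimately show ?thesis
      unfolding touches_def[symmetric]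
      using IH gap c less.prems(2)
      by (cases "f v = 1"; cases "touches v"; cases "even d") simp_all
  qed
qed

text \<open>The last ball has no right neighbour, so unless a full ball exists it touches its left
  one, and at most one vertex follows it. The touching bounds on its right end, increased by one,
  are the claimed bounds on \<open>n\<close>.\<close>

lemma maximal_packing_broadcast_path_graph_cost:
  assumes f: "maximal_packing_broadcast (path_graph n) f" and n: "2 \<le> n"
    and C: "C = broadcast_cost (path_graph n) f"
  shows "n \<le> 4 * C \<and> (odd C \<longrightarrow> n + 1 \<le> 4 * C)"
proof -
  have sep: "u + f u + f w < w"
    if "u \<in> {1..n}" "w \<in> {1..n}" "0 < f u" "0 < f w" "u < w" for u w
    using f that
    unfolding maximal_packing_broadcast_path_graph_iff packing_broadcast_path_graph_iff by blast
  have tight: "f u = max (u - 1) (n - u) \<or> (\<exists>w\<in>{1..n}. w \<noteq> u \<and> 0 < f w \<and>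
      u \<le> w + f u + f w + 1 \<and> w \<le> u + f u + f w + 1)" if "u \<in> {1..n}" for u
    using f that unfolding maximal_packing_broadcast_path_graph_iff by blast
  show ?thesis
  proof (cases "\<exists>v\<in>{1..n}. 0 < f v \<and> f v = max (v - 1) (n - v)")
    case True
    then obtain v where v: "v \<in> {1..n}" "0 < f v" "f v = max (v - 1) (n - v)" by blast
    \<comment> \<open>A full ball has radius at least \<open>(n - 1) / 2\<close>, so
      \<open>n\<close> is at most \<open>2 * C + 1\<close>, which is below \<open>4 * C\<close>
      because \<open>C\<close> is positive.\<close>
    have "f v \<le> C"
      unfolding C broadcast_cost_def using v(1) by (intro member_le_sum) auto
    moreover have "n \<le> 2 * f v + 1" using v by auto
    ultimately show ?thesis using v(2) by linarith
  next
    case False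
    define v where "v = Max {v \<in> {1..n}. 0 < f v}"
    have "\<exists>v\<in>{1..n}. 0 < f v" using tight[of 1] n by force
    then have "v \<in> {v \<in> {1..n}. 0 < f v}"
      unfolding v_def by (intro Max_in) auto
    then have v: "v \<in> {1..n}" "0 < f v" by auto
    have last: "u \<le> v" if "u \<in> {1..n}" "0 < f u" for u
      unfolding v_def using that by (intro Max_ge) auto
    have "n \<le> v + f v + 1"
    proof (rule ccontr)
      assume far: "\<not> n \<le> v + f v + 1"
      then have "f n = 0" using last[of n] by force
      then obtain w where w: "w \<in> {1..n}" "0 < f w" "n \<le> w + f w + 1"
        using tight[of n] n by force
      then show False
        using far last[of w] sep[of w v] v by (cases "w = v") auto
    qed
    moreover have "\<exists>w\<in>{1..n}. 0 < f w \<and> v = w + f w + f v + 1"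
    proof -
      obtain w where w: "w \<in> {1..n}" "w \<noteq> v" "0 < f w" "v \<le> w + f v + f w + 1"
        using tight[OF v(1)] False v by blast
      then have "v = w + f w + f v + 1" using last[of w] sep[of w v] v by force
      with w show ?thesis by blast
    qed
    moreover have "C = sum f {1..v}"
      unfolding C broadcast_cost_def pverts_path_graph
    proof (rule sum.mono_neutral_right)
      show "\<forall>i\<in>{1..n} - {1..v}. f i = 0"
      proof
        fix i
        assume "i \<in> {1..n} - {1..v}"
        with last[of i] show "f i = 0" by force
      qed
    qed (use v in auto)
    ultimately show ?thesis
      using maximal_packing_broadcast_prefix_bound[OF f n _ v, of C] False by force
  qed
qed

section \<open>Constructions for the upper bound\<close>

text \<open>The broadcast with value 1 on \<open>S\<close> and 0 elsewhere is maximal: distance 3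
  between centres means adjacent balls, and a vertex outside \<open>S\<close> is blocked as soon as
  a centre lies within distance 2.\<close>

lemma lower_broadcast_packing_number_path_graph_le_card:
  assumes "S \<subseteq> {1..n}"
    and sep: "\<And>u w. u \<in> S \<Longrightarrow> w \<in> S \<Longrightarrow> u < w \<Longrightarrow> u + 3 \<le> w"
    and dom: "\<And>u. u \<in> {1..n} \<Longrightarrow> \<exists>w\<in>S. u \<le> w + 2 \<and> w \<le> u + 2"
    and tight: "\<And>v. v \<in> S \<Longrightarrow> max (v - 1) (n - v) = 1 \<or> (\<exists>w\<in>S. v = w + 3 \<or> w = v + 3)"
    and "2 \<le> n"
  shows "p\<^sub>b (path_graph n) \<le> card S"
proof -
  define f :: "nat \<Rightarrow> nat" where "f = (\<lambda>v\<in>{1..n}. if v \<in> S then 1 else 0)"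
  have f1: "f v = 1" if "v \<in> S" for v using that assms(1) by (auto simp: f_def)
  have f0: "f v = 0" if "v \<in> {1..n}" "v \<notin> S" for v using that by (auto simp: f_def)
  have "packing_broadcast (path_graph n) f"
    unfolding packing_broadcast_path_graph_iff
  proof (intro conjI ballI impI)
    show "f \<in> extensional {1..n}" by (simp add: f_def)
    show "f v \<le> max (v - 1) (n - v)" if "v \<in> {1..n}" for v
      using that \<open>2 \<le> n\<close> by (auto simp: f_def)
    show "u + f u + f w < w"
      if "u \<in> {1..n}" "w \<in> {1..n}" "0 < f u" "0 < f w" "u < w" for u w
    proof -
      have "u \<in> S" "w \<in> S" using that f0[of u] f0[of w] by auto
      then show ?thesis using sep[of u w] that f1 by force
    qed
  qed
  moreover have "f v = max (v - 1) (n - v) \<or> (\<exists>w\<in>{1..n}. w \<noteq> v \<and> 0 < f w \<and>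
      v \<le> w + f v + f w + 1 \<and> w \<le> v + f v + f w + 1)" if v: "v \<in> {1..n}" for v
  proof (cases "v \<in> S")
    case True
    consider "max (v - 1) (n - v) = 1" | w where "w \<in> S" "v = w + 3 \<or> w = v + 3"
      using tight[OF True] by blast
    then show ?thesis
    proof cases
      case 1
      then show ?thesis using f1[OF True] by simp
    next
      case 2
      then show ?thesis using f1[OF True] f1[OF 2(1)] assms(1) by (intro disjI2 bexI[of _ w]) auto
    qed
  next
    case False
    obtain w where "w \<in> S" "v \<le> w + 2" "w \<le> v + 2" using dom[OF v] by blast
    then show ?thesis
      using f0[OF v False] f1[of w] assms(1) False by (intro disjI2 bexI[of _ w]) auto
  qed
  ultimately have "maximal_packing_broadcast (path_graph n) f"
    unfolding maximal_packing_broadcast_path_graph_iff by blast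
  then have "p\<^sub>b (path_graph n) \<le> broadcast_cost (path_graph n) f"
    unfolding lower_broadcast_packing_number_def
    by (intro Min_le) (auto intro!: finite_maximal_packing_broadcasts)
  also have "\<dots> = card S"
    using assms(1) by (simp add: broadcast_cost_def f_def sum.If_cases Int_absorb1)
  finally show ?thesis .
qed

text \<open>These are \<open>p + 1\<close> pairs of adjacent radius-one balls. A pair covers six
  vertices and two uncovered ones follow, hence the period 8; \<open>s\<close> places the pattern
  relative to the left end.\<close>

definition pair_centres :: "nat \<Rightarrow> nat \<Rightarrow> nat set" where
  "pair_centres p s = (\<lambda>i. 8 * i + s) ` {..p} \<union> (\<lambda>i. 8 * i + s + 3) ` {..p}"

lemma mem_pair_centres:
  "v \<in> pair_centres p s \<longleftrightarrow> (\<exists>i\<le>p. v = 8 * i + s \<or> v = 8 * i + s + 3)"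
  by (auto simp: pair_centres_def)

lemma finite_pair_centres: "finite (pair_centres p s)"
  by (simp add: pair_centres_def)

lemma card_pair_centres_le: "card (pair_centres p s) \<le> 2 * p + 2"
proof -
  have "card (pair_centres p s) \<le>
      card ((\<lambda>i. 8 * i + s) ` {..p}) + card ((\<lambda>i. 8 * i + s + 3) ` {..p})"
    unfolding pair_centres_def by (rule card_Un_le)
  also have "\<dots> \<le> card {..p} + card {..p}"
    by (intro add_mono card_image_le) auto
  finally show ?thesis by simp
qed

lemma pair_centres_sep:
  assumes "u \<in> pair_centres p s" "w \<in> pair_centres p s" "u < w"
  shows "u + 3 \<le> w"
proof -
  obtain i j where "u = 8 * i + s \<or> u = 8 * i + s + 3" "w = 8 * j + s \<or> w = 8 * j + s + 3"
    using assms unfolding mem_pair_centres by blast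
  with \<open>u < w\<close> show ?thesis by (cases i j rule: linorder_cases) auto
qed

text \<open>Within distance 2, the pair at \<open>a\<close> and \<open>a + 3\<close> reaches the
  eight vertices from \<open>a - 2\<close> to \<open>a + 5\<close>, and these blocks tile. The
  condition \<open>s \<le> 3\<close> makes the first block start at vertex 1 or earlier.\<close>

lemma pair_centres_dom:
  assumes "s \<le> 3" "1 \<le> u" "u \<le> 8 * p + s + 5"
  shows "\<exists>w\<in>pair_centres p s. u \<le> w + 2 \<and> w \<le> u + 2"
proof -
  \<comment> \<open>The offset of \<open>u\<close> from the start \<open>s - 2\<close> of the first
    block; the subtraction does not truncate because \<open>u + 2\<close> is at least 3.\<close>
  define k where "k = u + 2 - s"
  have k: "u + 2 = k + s" using assms by (simp add: k_def)
  define i where "i = k div 8"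
  have "8 * i \<le> k" "k \<le> 8 * i + 7" by (simp_all add: i_def)
  with k assms have i: "8 * i + s \<le> u + 2" "u + 2 \<le> 8 * i + s + 7" "i \<le> p" by linarith+
  show ?thesis
  proof (cases "u \<le> 8 * i + s + 2")
    case True
    with i show ?thesis by (intro bexI[of _ "8 * i + s"]) (auto simp: mem_pair_centres)
  next
    case False
    with i show ?thesis by (intro bexI[of _ "8 * i + s + 3"]) (auto simp: mem_pair_centres)
  qed
qed

lemma pair_centres_tight:
  assumes "v \<in> pair_centres p s"
  shows "\<exists>w\<in>pair_centres p s. v = w + 3 \<or> w = v + 3"
proof -
  obtain i where "i \<le> p" and v: "v = 8 * i + s \<or> v = 8 * i + s + 3"
    using assms unfolding mem_pair_centres by blast
  then have "8 * i + s \<in> pair_centres p s" "8 * i + s + 3 \<in> pair_centres p s"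
    unfolding mem_pair_centres by blast+
  with v show ?thesis by metis
qed

text \<open>The path may end anywhere from the last centre \<open>8 * p + s + 3\<close> to the last
  vertex within distance 2 of it.\<close>

lemma lower_broadcast_packing_number_path_graph_le_even:
  assumes "1 \<le> s" "s \<le> 3" "8 * p + s + 3 \<le> n" "n \<le> 8 * p + s + 5"
  shows "p\<^sub>b (path_graph n) \<le> 2 * p + 2"
proof -
  have "p\<^sub>b (path_graph n) \<le> card (pair_centres p s)"
  proof (rule lower_broadcast_packing_number_path_graph_le_card)
    show "pair_centres p s \<subseteq> {1..n}"
      using assms by (auto simp: mem_pair_centres)
    show "\<exists>w\<in>pair_centres p s. u \<le> w + 2 \<and> w \<le> u + 2" if "u \<in> {1..n}" for u
      using that assms by (intro pair_centres_dom) auto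
  qed (use assms pair_centres_sep pair_centres_tight in auto)
  also have "\<dots> \<le> 2 * p + 2" by (rule card_pair_centres_le)
  finally show ?thesis .
qed

text \<open>A third ball adjacent to the last pair raises the cost by one and extends the reach by
  three vertices, up to \<open>n\<close>.\<close>

lemma lower_broadcast_packing_number_path_graph_le_odd:
  assumes "1 \<le> s" "s \<le> 3" "n = 8 * p + s + 8"
  shows "p\<^sub>b (path_graph n) \<le> 2 * p + 3"
proof -
  let ?x = "8 * p + s + 6"
  let ?S = "insert ?x (pair_centres p s)"
  have below: "v + 3 \<le> ?x" if "v \<in> pair_centres p s" for v
    using that by (auto simp: mem_pair_centres)
  have touch: "8 * p + s + 3 \<in> pair_centres p s" by (auto simp: mem_pair_centres)
  have "p\<^sub>b (path_graph n) \<le> card ?S"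
  proof (rule lower_broadcast_packing_number_path_graph_le_card)
    show "?S \<subseteq> {1..n}"
      using assms by (auto simp: mem_pair_centres)
    show "u + 3 \<le> w" if "u \<in> ?S" "w \<in> ?S" "u < w" for u w
      using that below pair_centres_sep[of u p s w] by force
    show "\<exists>w\<in>?S. u \<le> w + 2 \<and> w \<le> u + 2" if u: "u \<in> {1..n}" for u
    proof (cases "u \<le> 8 * p + s + 5")
      case True
      then show ?thesis using pair_centres_dom[of s u p] assms u by auto
    next
      case False
      then show ?thesis using assms u by auto
    qed
    show "max (v - 1) (n - v) = 1 \<or> (\<exists>w\<in>?S. v = w + 3 \<or> w = v + 3)" if "v \<in> ?S" for v
    proof (cases "v = ?x")
      case True
      then have "v = (8 * p + s + 3) + 3" by simp
      with touch show ?thesis by blast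
    next
      case False
      with that pair_centres_tight[of v p s] show ?thesis by auto
    qed
  qed (use assms in auto)
  also have "\<dots> \<le> Suc (card (pair_centres p s))"
    by (simp add: card_insert_if finite_pair_centres)
  also have "\<dots> \<le> 2 * p + 3" using card_pair_centres_le[of p s] by simp
  finally show ?thesis .
qed

text \<open>On these paths the radius-one ball at 2 is full, so it needs no adjacent
  partner.\<close>

lemma lower_broadcast_packing_number_path_graph_le_one:
  assumes "n = 2 \<or> n = 3"
  shows "p\<^sub>b (path_graph n) \<le> 1"
proof -
  have "p\<^sub>b (path_graph n) \<le> card {2 :: nat}"
    by (rule lower_broadcast_packing_number_path_graph_le_card) (use assms in auto)
  then show ?thesis by simp
qed

section \<open>Matching the bounds in each residue class modulo 8\<close>

theorem theorem3p16:
  fixes n :: nat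
  assumes "n \<ge> 2"
  shows "p\<^sub>b (path_graph n) =
    (if n mod 8 = 0 then n div 4
     else if n mod 8 \<in> {1, 2, 3} then 2 * (n div 8) + 1
     else 2 * (n div 8) + 2)"
    (is "_ = ?R")
proof (rule antisym)
  define q r where "q = n div 8" and "r = n mod 8"
  have n: "n = 8 * q + r" "r < 8" by (simp_all add: q_def r_def)
  consider "r = 0" | "r \<in> {1, 2, 3}" "q = 0" | "r \<in> {1, 2, 3}" "0 < q" | "r \<in> {4, 5, 6}" | "r = 7"
    using n(2) by fastforce
  \<comment> \<open>For \<open>r = 0\<close> the last of the \<open>q\<close> pairs must reach the
    end of the path, which forces offset 3. For \<open>r\<close> in 1, 2, 3 with \<open>q\<close>
    positive, \<open>q\<close> pairs at offset \<open>r\<close> plus a third ball end exactly at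
    \<open>n\<close>. For larger \<open>r\<close>, \<open>q + 1\<close> pairs fit, with offset 1 up
    to \<open>r = 6\<close> and offset 2 for \<open>r = 7\<close>.\<close>
  then show "p\<^sub>b (path_graph n) \<le> ?R"
  proof cases
    case 1
    with assms n obtain p where "q = Suc p" by (cases q) auto
    with 1 n show ?thesis
      using lower_broadcast_packing_number_path_graph_le_even[of 3 p n] by simp
  next
    case 2
    with assms n show ?thesis
      using lower_broadcast_packing_number_path_graph_le_one[of n] by auto
  next
    case 3
    then obtain p where "q = Suc p" by (cases q) auto
    with 3 n show ?thesis
      using lower_broadcast_packing_number_path_graph_le_odd[of r n p] by auto
  next
    case 4
    with n show ?thesis
      using lower_broadcast_packing_number_path_graph_le_even[of 1 q n] by auto
  next
    case 5
    with n show ?thesis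
      using lower_broadcast_packing_number_path_graph_le_even[of 2 q n] by auto
  qed
  have "p\<^sub>b (path_graph n) \<in>
      broadcast_cost (path_graph n) ` {f. maximal_packing_broadcast (path_graph n) f}"
    unfolding lower_broadcast_packing_number_def
    using maximal_packing_broadcast_exists[of "path_graph n"]
    by (intro Min_in) (auto intro!: finite_maximal_packing_broadcasts)
  then obtain f where "maximal_packing_broadcast (path_graph n) f"
    "p\<^sub>b (path_graph n) = broadcast_cost (path_graph n) f" by auto
  from maximal_packing_broadcast_path_graph_cost[OF this(1) assms this(2)]
  have bound: "n \<le> 4 * p\<^sub>b (path_graph n)"
    and odd_bound: "odd (p\<^sub>b (path_graph n)) \<Longrightarrow> n + 1 \<le> 4 * p\<^sub>b (path_graph n)" by auto
  consider "r = 0" | "r \<in> {1, 2, 3}" | "4 \<le> r"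
    using n(2) by fastforce
  then show "?R \<le> p\<^sub>b (path_graph n)"
  proof cases
    case 1
    then show ?thesis using bound n by simp
  next
    case 2
    then have "2 * q + 1 \<le> p\<^sub>b (path_graph n)" using bound n by auto
    then show ?thesis using 2 by (auto simp: q_def r_def)
  next
    case 3
    \<comment> \<open>For \<open>r = 4\<close> the plain bound still allows
      \<open>2 * q + 1\<close>. This value is odd, so the parity refinement would require
      \<open>n + 1 \<le> 8 * q + 4\<close>, which fails.\<close>
    then have "p\<^sub>b (path_graph n) \<noteq> 2 * q + 1" using odd_bound n by force
    then have "2 * q + 2 \<le> p\<^sub>b (path_graph n)" using 3 bound n(1) by linarith
    then show ?thesis using 3 by (auto simp: q_def r_def)
  qed
qed

end
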